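(* For each $j\in\mathbb{N}$ let $(q^{(j)}_k)_{k\ge1}$ be a sequence of positive integers with $q^{(j)}_{k+1}\ge q^{(j)}_k(q^{(j)}_k+1)$ for all $k\ge1$, and suppose that $$\sum_{j=1}^\infty\frac1{q^{(j)}_k}<+\infty\quad\text{for every }k\ge1.$$ Let $\{\xi^{(j)}_k\}_{j,k\ge1}$ be mutually independent random variables taking the values $0$ and $1$ with probabilities $p^{(j)}_{0k}$ and $p^{(j)}_{1k}$ respectively ($p^{(j)}_{0k},p^{(j)}_{1k}\ge 0$, $p^{(j)}_{0k}+p^{(j)}_{1k}=1$), and let $$\widetilde\psi_\infty=\sum_{j=1}^\infty\left(\sum_{k=1}^\infty\frac{(-1)^{k+1}\xi^{(j)}_k}{q^{(j)}_k}\right).$$ Then $\widetilde\psi_\infty$ is of pure type, i.e. its distribution is either purely discrete, or purely singularly continuous, or purely absolutely continuous (with respect to Lebesgue measure). Moreover, $\widetilde\psi_\infty$ has a purely discrete distribution if and only if $$\prod_{j=1}^\infty\left(\prod_{k=1}^\infty\max\{p^{(j)}_{0k},p^{(j)}_{1k}\}\right)>0.$$ *)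

theory Defs
  imports "HOL-Probability.Probability"
begin

definition purely_discrete :: "real measure \<Rightarrow> bool" where
  "purely_discrete \<mu> \<longleftrightarrow> (\<exists>A. countable A \<and> (AE x in \<mu>. x \<in> A))"

definition purely_absolutely_continuous :: "real measure \<Rightarrow> bool" where
  "purely_absolutely_continuous \<mu> \<longleftrightarrow> absolutely_continuous lborel \<mu>"

definition purely_singularly_continuous :: "real measure \<Rightarrow> bool" where
  "purely_singularly_continuous \<mu> \<longleftrightarrow>
     (\<forall>x. emeasure \<mu> {x} = 0) \<and> (\<exists>N\<in>null_sets lborel. AE x in \<mu>. x \<in> N)"

definition pure_type :: "real measure \<Rightarrow> bool" where
  "pure_type \<mu> \<longleftrightarrow>
     purely_discrete \<mu> \<or> purely_singularly_continuous \<mu> \<or> purely_absolutely_continuous \<mu>"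

text \<open>The three alternatives are mutually exclusive for Borel probability measures.\<close>

lemma pure_types_exclusive:
  assumes "prob_space \<mu>" and [simp, measurable_cong]: "sets \<mu> = sets borel"
  shows "\<not> (purely_discrete \<mu> \<and> purely_singularly_continuous \<mu>)"
    and "\<not> (purely_discrete \<mu> \<and> purely_absolutely_continuous \<mu>)"
    and "\<not> (purely_singularly_continuous \<mu> \<and> purely_absolutely_continuous \<mu>)"
proof -
  interpret prob_space \<mu> by fact
  have no: False if "AE x in \<mu>. x \<in> A" "A \<in> null_sets \<mu>" for A
  proof -
    have "AE x in \<mu>. False"
      using that(1) AE_not_in[OF that(2)] by eventually_elim auto
    then show False by simp
  qed
  show "\<not> (purely_discrete \<mu> \<and> purely_singularly_continuous \<mu>)"
  proof
    assume "purely_discrete \<mu> \<and> purely_singularly_continuous \<mu>"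
    then obtain A where A: "countable A" "AE x in \<mu>. x \<in> A" "\<And>x. emeasure \<mu> {x} = 0"
      unfolding purely_discrete_def purely_singularly_continuous_def by blast
    have "(\<Union>x\<in>A. {x}) \<in> null_sets \<mu>"
      using A by (intro null_sets_UN') (auto intro!: null_setsI)
    with A(2) no[of A] show False by simp
  qed
  show "\<not> (purely_discrete \<mu> \<and> purely_absolutely_continuous \<mu>)"
    unfolding purely_discrete_def purely_absolutely_continuous_def absolutely_continuous_def
    using no countable_imp_null_set_lborel by blast
  show "\<not> (purely_singularly_continuous \<mu> \<and> purely_absolutely_continuous \<mu>)"
    unfolding purely_singularly_continuous_def purely_absolutely_continuous_def
      absolutely_continuous_def
    using no by blast
qed

text \<open>
  Infinite products are limits of partial products. The library's \<^const>\<open>prodinf\<close> is not used because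
  it leaves the product unspecified when nonzero factors have partial products tending to 0; here
  such a product has value 0. All uses are for factors in \<open>[0, 1]\<close>, where the limit exists.
\<close>

definition inf_product :: "(nat \<Rightarrow> real) \<Rightarrow> real" where
  "inf_product f = lim (\<lambda>n. \<Prod>k=1..n. f k)"

text \<open>
  Indices \<open>j\<close> and \<open>k\<close> start at 1; values at index 0 are irrelevant.
\<close>

definition ostrogradsky_sum ::
    "(nat \<Rightarrow> nat \<Rightarrow> nat) \<Rightarrow> (nat \<Rightarrow> nat \<Rightarrow> 'a \<Rightarrow> real) \<Rightarrow> 'a \<Rightarrow> real" where
  "ostrogradsky_sum q \<xi> \<omega> =
     (\<Sum>j. \<Sum>k. (-1) ^ (Suc k + 1) * \<xi> (Suc j) (Suc k) \<omega> / real (q (Suc j) (Suc k)))"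

end

theory Submission
  imports Defs
begin

text \<open>
  The growth of the denominators makes the double series absolutely convergent, uniformly in the
  digits, so it may be enumerated as a single series \<open>\<Sum>i. a i * X i\<close> with nonzero,
  absolutely summable coefficients and independent digits \<open>X i\<close> with values 0 and 1. Such
  series are treated in the locale \<open>bernoulli_series\<close> below.
  
  Purity. A Borel set that is invariant under translation by every \<open>a i\<close> contains the sum or
  not irrespective of any finite number of digits, so by Kolmogorov's law it has probability 0 or 1.
  If a Borel set \<open>A\<close> has positive probability, then the union of its translates by the
  countable group generated by the \<open>a i\<close> is invariant, hence has probability 1. This union is
  countable if \<open>A\<close> is, and Lebesgue null if \<open>A\<close> is. So a single atom makes the
  distribution discrete; without atoms, a single charged null set makes it singularly continuous.
  
  Discreteness. Let \<open>mode_prob i\<close> be the probability of the most likely value of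
  \<open>X i\<close>. If the product of the \<open>mode_prob i\<close> is positive, then with
  positive probability all digits are the most likely ones, which gives an atom. For the converse, let
  \<open>concentration n\<close> be the supremum of the probabilities of single values of the remainder
  \<open>tail n = (\<Sum>i\<ge>n. a i * X i)\<close>. Two facts are combined. If the sum has an atom,
  then some remainder has concentration above 1/2 (\<open>concentration_gt_half\<close>). Moreover,
  \<open>2 * concentration n - 1\<close> is at most
  \<open>(2 * mode_prob n - 1) * (2 * concentration (Suc n) - 1)\<close> (\<open>concentration_step\<close>),
  because the two shifts by 0 and \<open>a n \<noteq> 0\<close> put distinct atoms of the next remainder on top
  of each other, and at most one of them can exceed 1/2. The concentration does not decrease with
  \<open>n\<close>. Iteration of the inequality from a remainder with
  concentration above 1/2 bounds the partial products of the \<open>mode_prob i\<close> away from 0.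
\<close>

section \<open>Atoms of a sum of independent variables\<close>

text \<open>
  Conditionally on \<open>U\<close>, the sum equals \<open>c\<close> only if \<open>V\<close> takes the one value
  \<open>c - U\<close>, which has probability at most \<open>Q\<close>. The restriction to a set \<open>B\<close> of
  values of \<open>U\<close> is what makes the bound sharp enough for \<open>concentration_gt_half\<close>.
\<close>

lemma (in prob_space) indep_sum_atom_le:
  fixes U V :: "'a \<Rightarrow> real"
  assumes indep: "indep_var borel U borel V"
    and atoms: "\<And>y. prob {\<omega> \<in> space M. V \<omega> = y} \<le> Q"
    and B: "B \<in> sets borel"
  shows "prob {\<omega> \<in> space M. U \<omega> \<in> B \<and> U \<omega> + V \<omega> = c} \<le> Q * prob {\<omega> \<in> space M. U \<omega> \<in> B}"
proof -
  have [measurable]: "U \<in> borel_measurable M" "V \<in> borel_measurable M"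
    using indep_var_rv1[OF indep] indep_var_rv2[OF indep] by auto
  note B[measurable]
  interpret V: prob_space "distr M borel V" by (rule prob_space_distr) simp
  define W where "W = {(u, v). u \<in> B \<and> u + v = (c::real)}"
  have "W = (\<lambda>x. (fst x, fst x + snd x)) -` (B \<times> {c}) \<inter> space (borel \<Otimes>\<^sub>M borel)"
    by (auto simp: W_def space_pair_measure)
  also have "\<dots> \<in> sets (borel \<Otimes>\<^sub>M borel)"
    by (rule measurable_sets[where A="borel \<Otimes>\<^sub>M borel"]) (use B in auto)
  finally have W [measurable]: "W \<in> sets (borel \<Otimes>\<^sub>M borel)" .
  have "emeasure M {\<omega> \<in> space M. U \<omega> \<in> B \<and> U \<omega> + V \<omega> = c}
      = emeasure (distr M (borel \<Otimes>\<^sub>M borel) (\<lambda>\<omega>. (U \<omega>, V \<omega>))) W"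
    by (subst emeasure_distr[OF _ W]) (measurable, auto simp: W_def intro!: arg_cong[where f="emeasure M"])
  also have "\<dots> = emeasure (distr M borel U \<Otimes>\<^sub>M distr M borel V) W"
    using indep by (simp add: indep_var_distribution_eq)
  also have "\<dots> = (\<integral>\<^sup>+u. emeasure (distr M borel V) (Pair u -` W) \<partial>distr M borel U)"
    by (intro V.emeasure_pair_measure_alt) (simp cong: sets_pair_measure_cong)
  also have "\<dots> \<le> (\<integral>\<^sup>+u. ennreal Q * indicator B u \<partial>distr M borel U)"
  proof (intro nn_integral_mono)
    fix u
    have "Pair u -` W = (if u \<in> B then {c - u} else {})" by (auto simp: W_def)
    moreover have "emeasure (distr M borel V) {c - u} \<le> ennreal Q"
    proof -
      have "emeasure (distr M borel V) {c - u} = emeasure M {\<omega> \<in> space M. V \<omega> = c - u}"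
        by (subst emeasure_distr) (auto intro!: arg_cong[where f="emeasure M"])
      then show ?thesis using atoms[of "c - u"] by (simp add: emeasure_eq_measure ennreal_leI)
    qed
    ultimately show "emeasure (distr M borel V) (Pair u -` W) \<le> ennreal Q * indicator B u"
      by (auto simp: indicator_def)
  qed
  also have "\<dots> = ennreal Q * emeasure (distr M borel U) B"
    by (simp add: nn_integral_cmult_indicator)
  also have "emeasure (distr M borel U) B = emeasure M {\<omega> \<in> space M. U \<omega> \<in> B}"
    by (subst emeasure_distr) (auto intro!: arg_cong[where f="emeasure M"])
  finally show ?thesis
    using order_trans[OF measure_nonneg atoms[of 0]]
    by (simp add: emeasure_eq_measure flip: ennreal_mult)
qed

section \<open>Series with independent zero-one digits\<close>

locale bernoulli_series = prob_space M for M :: "'a measure" +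
  fixes a :: "nat \<Rightarrow> real" and X :: "nat \<Rightarrow> 'a \<Rightarrow> real"
  assumes indep: "indep_vars (\<lambda>_. borel) X UNIV"
    and X_01: "X n \<omega> = 0 \<or> X n \<omega> = 1"
    and summable_abs: "summable (\<lambda>n. \<bar>a n\<bar>)"
begin

definition tail :: "nat \<Rightarrow> 'a \<Rightarrow> real" where
  "tail n \<omega> = (\<Sum>i. a (i + n) * X (i + n) \<omega>)"

definition mode_prob :: "nat \<Rightarrow> real" where
  "mode_prob n = max (prob {\<omega> \<in> space M. X n \<omega> = 0}) (prob {\<omega> \<in> space M. X n \<omega> = 1})"

definition concentration :: "nat \<Rightarrow> real" where
  "concentration n = (SUP y. prob {\<omega> \<in> space M. tail n \<omega> = y})"

lemma X_measurable [measurable]: "X n \<in> borel_measurable M"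
  using indep by (auto simp: indep_vars_def)

lemma tail_measurable [measurable]: "tail n \<in> borel_measurable M"
  unfolding tail_def[abs_def] by measurable

lemma term_le: "\<bar>a n * X n \<omega>\<bar> \<le> \<bar>a n\<bar>"
  using X_01[of n \<omega>] by auto

lemma summable_terms: "summable (\<lambda>i. a (i + n) * X (i + n) \<omega>)"
  by (rule summable_comparison_test'[OF summable_abs[THEN summable_ignore_initial_segment[of _ n]]])
     (simp only: real_norm_def term_le)

lemma tail_split: "tail 0 \<omega> = (\<Sum>i<n. a i * X i \<omega>) + tail n \<omega>"
  using suminf_split_initial_segment[OF summable_terms[of 0 \<omega>], of n] by (simp add: tail_def)

lemma tail_Suc: "tail n \<omega> = a n * X n \<omega> + tail (Suc n) \<omega>"
  using suminf_split_head[OF summable_terms[of n \<omega>]] by (simp add: tail_def)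

lemma abs_tail_le: "\<bar>tail n \<omega>\<bar> \<le> (\<Sum>i. \<bar>a (i + n)\<bar>)"
  unfolding tail_def
  using norm_suminf_le[of "\<lambda>i. a (i + n) * X (i + n) \<omega>" "\<lambda>i. \<bar>a (i + n)\<bar>"]
    summable_abs[THEN summable_ignore_initial_segment[of _ n]] term_le
  by simp

text \<open>
  The function \<open>f\<close> is arbitrary because two cases are needed: a single digit and a partial sum.
\<close>

lemma indep_prefix_tail:
  assumes A: "A \<subseteq> {..<n}" and f: "f \<in> borel_measurable (PiM A (\<lambda>_. borel))"
  shows "indep_var borel (\<lambda>\<omega>. f (\<lambda>i\<in>A. X i \<omega>)) borel (tail n)"
proof -
  have "indep_var (PiM A (\<lambda>_. borel)) (\<lambda>\<omega>. \<lambda>i\<in>A. X i \<omega>) (PiM {n..} (\<lambda>_. borel)) (\<lambda>\<omega>. \<lambda>i\<in>{n..}. X i \<omega>)"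
    using A by (intro indep_var_restrict[OF indep]) auto
  moreover have "(\<lambda>x. \<Sum>i. a (i + n) * x (i + n)) \<in> borel_measurable (PiM {n..} (\<lambda>_. borel))"
    by measurable
  ultimately have "indep_var borel (f \<circ> (\<lambda>\<omega>. \<lambda>i\<in>A. X i \<omega>))
      borel ((\<lambda>x. \<Sum>i. a (i + n) * x (i + n)) \<circ> (\<lambda>\<omega>. \<lambda>i\<in>{n..}. X i \<omega>))"
    using f by (intro indep_var_compose)
  then show ?thesis
    by (simp add: comp_def tail_def[abs_def])
qed

section \<open>Purity of the distribution\<close>

text \<open>
  Removing the first \<open>n\<close> terms translates the sum by finitely many coefficients, which does
  not affect membership in \<open>B\<close>. The event is therefore determined by the digits from
  \<open>n\<close> on, for every \<open>n\<close>, and Kolmogorov's zero-one law applies.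
\<close>

lemma tail_zero_one:
  assumes B: "B \<in> sets borel" and inv: "\<And>x n. x + a n \<in> B \<longleftrightarrow> x \<in> B"
  shows "prob {\<omega> \<in> space M. tail 0 \<omega> \<in> B} \<in> {0, 1}"
proof -
  define F where "F i = sigma_sets (space M) {X i -` A \<inter> space M | A. A \<in> sets borel}" for i
  have tail_eq: "{\<omega> \<in> space M. tail 0 \<omega> \<in> B} = {\<omega> \<in> space M. tail n \<omega> \<in> B}" for n
  proof -
    have "tail 0 \<omega> \<in> B \<longleftrightarrow> tail n \<omega> \<in> B" for \<omega>
    proof (induction n)
      case (Suc n)
      then show ?case
        using X_01[of n \<omega>] tail_Suc[of n \<omega>] inv[of "tail (Suc n) \<omega>" n] by (auto simp: add.commute)
    qed simp
    then show ?thesis by simp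
  qed
  have "{\<omega> \<in> space M. tail 0 \<omega> \<in> B} \<in> tail_events F"
    unfolding tail_events_def
  proof (intro INT_I)
    fix n
    define N where "N = sigma (space M) (\<Union> (F ` {n..}))"
    have F_sub: "F i \<subseteq> Pow (space M)" for i
      unfolding F_def by (auto dest!: sigma_sets_into_sp[rotated])
    have sets_N: "sets N = sigma_sets (space M) (\<Union> (F ` {n..}))"
      unfolding N_def using F_sub by (intro sets_measure_of) blast
    have [simp]: "space N = space M"
      unfolding N_def using F_sub by (intro space_measure_of) blast
    have "X i \<in> borel_measurable N" if "n \<le> i" for i
    proof (rule measurableI)
      fix A :: "real set" assume "A \<in> sets borel"
      then have "X i -` A \<inter> space M \<in> F i" by (auto simp: F_def)
      with that show "X i -` A \<inter> space N \<in> sets N" by (auto simp: sets_N)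
    qed simp
    then have [measurable]: "X (i + n) \<in> borel_measurable N" for i by simp
    have "tail n \<in> borel_measurable N"
      unfolding tail_def[abs_def] by measurable
    from measurable_sets[OF this B]
    show "{\<omega> \<in> space M. tail 0 \<omega> \<in> B} \<in> sigma_sets (space M) (\<Union> (F ` {n..}))"
      by (simp add: tail_eq[of n] sets_N vimage_def Int_def conj_commute)
  qed
  moreover have "indep_sets F UNIV"
    using indep by (simp add: indep_vars_def F_def[abs_def])
  moreover have "sigma_algebra (space M) (F i)" for i
    unfolding F_def by (rule sigma_algebra_sigma_sets) auto
  ultimately show ?thesis
    using kolmogorov_0_1_law[of F] by blast
qed


text \<open>
  The translates are taken over the subgroup generated by the coefficients. Its elements are written
  as signed sums along lists, which makes countability immediate and turns translation by a
  coefficient into prepending one entry.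
\<close>

lemma positive_mass_spreads:
  assumes A: "A \<in> sets borel" and pos: "prob {\<omega> \<in> space M. tail 0 \<omega> \<in> A} > 0"
  shows "\<exists>T. countable T \<and> (AE \<omega> in M. \<exists>t\<in>T. tail 0 \<omega> - t \<in> A)"
proof -
  define s :: "(bool \<times> nat) list \<Rightarrow> real"
    where "s l = sum_list (map (\<lambda>(b, n). if b then a n else - a n) l)" for l
  define B where "B = (\<Union>l. {x. x - s l \<in> A})"
  have "(\<lambda>x. x - s l) -` A \<inter> space borel \<in> sets borel" for l
    by (rule measurable_sets[OF _ A]) simp
  then have B: "B \<in> sets borel"
    unfolding B_def by (intro sets.countable_UN) (auto simp: vimage_def)
  have inv: "x + a n \<in> B \<longleftrightarrow> x \<in> B" for x n
  proof
    assume "x + a n \<in> B"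
    then obtain l where "x + a n - s l \<in> A" by (auto simp: B_def)
    then have "x - s ((False, n) # l) \<in> A" by (simp add: s_def algebra_simps)
    then show "x \<in> B" unfolding B_def by blast
  next
    assume "x \<in> B"
    then obtain l where "x - s l \<in> A" by (auto simp: B_def)
    then have "x + a n - s ((True, n) # l) \<in> A" by (simp add: s_def algebra_simps)
    then show "x + a n \<in> B" unfolding B_def by blast
  qed
  have "A \<subseteq> B"
  proof
    fix x assume "x \<in> A"
    then have "x - s [] \<in> A" by (simp add: s_def)
    then show "x \<in> B" unfolding B_def by blast
  qed
  with B have "prob {\<omega> \<in> space M. tail 0 \<omega> \<in> A} \<le> prob {\<omega> \<in> space M. tail 0 \<omega> \<in> B}"
    by (intro finite_measure_mono) auto
  with pos tail_zero_one[OF B inv] have "prob {\<omega> \<in> space M. tail 0 \<omega> \<in> B} = 1"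
    by auto
  with B have "AE \<omega> in M. tail 0 \<omega> \<in> B"
    by (subst (asm) prob_Collect_eq_1) auto
  then have "AE \<omega> in M. \<exists>t\<in>range s. tail 0 \<omega> - t \<in> A"
    by eventually_elim (auto simp: B_def)
  then show ?thesis by (intro exI[of _ "range s"]) auto
qed

lemma purely_discrete_if_atom:
  assumes "prob {\<omega> \<in> space M. tail 0 \<omega> = x} > 0"
  shows "purely_discrete (distr M borel (tail 0))"
proof -
  from positive_mass_spreads[of "{x}"] assms obtain T
    where T: "countable T" "AE \<omega> in M. \<exists>t\<in>T. tail 0 \<omega> - t \<in> {x}" by auto
  define A where "A = (\<lambda>t. x + t) ` T"
  have A: "countable A" using T by (simp add: A_def)
  then have [measurable]: "A \<in> sets borel" by (rule sets.countable[rotated]) simp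
  have "AE \<omega> in M. tail 0 \<omega> \<in> A"
    using T(2) by eventually_elim (auto simp: A_def image_iff algebra_simps)
  then have "AE x in distr M borel (tail 0). x \<in> A"
    by (subst AE_distr_iff) auto
  with A show ?thesis unfolding purely_discrete_def by blast
qed

lemma null_carrier_if_null_mass:
  assumes N: "N \<in> null_sets lborel" and pos: "prob {\<omega> \<in> space M. tail 0 \<omega> \<in> N} > 0"
  shows "\<exists>N'\<in>null_sets lborel. AE x in distr M borel (tail 0). x \<in> N'"
proof -
  from N have "N \<in> sets borel" by auto
  from positive_mass_spreads[OF this pos] obtain T
    where T: "countable T" "AE \<omega> in M. \<exists>t\<in>T. tail 0 \<omega> - t \<in> N" by auto
  define N' where "N' = (\<Union>t\<in>T. {x. x - t \<in> N})"
  have N': "N' \<in> null_sets lborel"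
    unfolding N'_def using T(1) by (rule null_sets_UN') (rule null_sets_translation[OF N])
  then have [measurable]: "N' \<in> sets borel" by auto
  have "AE \<omega> in M. tail 0 \<omega> \<in> N'"
    using T(2) by eventually_elim (auto simp: N'_def)
  then have "AE x in distr M borel (tail 0). x \<in> N'"
    by (subst AE_distr_iff) auto
  with N' show ?thesis by blast
qed

lemma emeasure_distr_tail:
  "A \<in> sets borel \<Longrightarrow> emeasure (distr M borel (tail 0)) A = prob {\<omega> \<in> space M. tail 0 \<omega> \<in> A}"
  by (subst emeasure_distr) (auto simp: emeasure_eq_measure vimage_def Int_def conj_commute)

theorem pure_type: "pure_type (distr M borel (tail 0))"
proof (cases "\<exists>x. prob {\<omega> \<in> space M. tail 0 \<omega> = x} > 0")
  case True
  then show ?thesis using purely_discrete_if_atom by (auto simp: pure_type_def)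
next
  case False
  then have "prob {\<omega> \<in> space M. tail 0 \<omega> = x} = 0" for x
    using measure_nonneg[of M] by (metis less_eq_real_def)
  then have no_atom: "emeasure (distr M borel (tail 0)) {x} = 0" for x
    by (simp add: emeasure_distr_tail)
  show ?thesis
  proof (cases "\<exists>N\<in>null_sets lborel. prob {\<omega> \<in> space M. tail 0 \<omega> \<in> N} > 0")
    case True
    with null_carrier_if_null_mass no_atom show ?thesis
      unfolding pure_type_def purely_singularly_continuous_def by blast
  next
    case False
    have "N \<in> null_sets (distr M borel (tail 0))" if "N \<in> null_sets lborel" for N
    proof -
      have "prob {\<omega> \<in> space M. tail 0 \<omega> \<in> N} = 0"
        using False that measure_nonneg[of M] by (metis less_eq_real_def)
      with that show ?thesis
        by (intro null_setsI) (auto simp: emeasure_distr_tail)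
    qed
    then show ?thesis
      unfolding pure_type_def purely_absolutely_continuous_def absolutely_continuous_def by blast
  qed
qed


section \<open>Discreteness and the product of the mode probabilities\<close>

lemma prob_X: "prob {\<omega> \<in> space M. X n \<omega> = 0} + prob {\<omega> \<in> space M. X n \<omega> = 1} = 1"
proof -
  have "prob {\<omega> \<in> space M. X n \<omega> = 0} + prob {\<omega> \<in> space M. X n \<omega> = 1}
      = prob ({\<omega> \<in> space M. X n \<omega> = 0} \<union> {\<omega> \<in> space M. X n \<omega> = 1})"
    by (intro finite_measure_Union[symmetric]) auto
  also have "{\<omega> \<in> space M. X n \<omega> = 0} \<union> {\<omega> \<in> space M. X n \<omega> = 1} = space M"
    using X_01 by blast
  finally show ?thesis by (simp add: prob_space)
qed

lemma mode_prob_bounds: "1 / 2 \<le> mode_prob n" "mode_prob n \<le> 1"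
  using prob_X[of n] unfolding mode_prob_def by (auto simp: max_def)

text \<open>
  By independence, all digits take their most likely value simultaneously with positive probability,
  and on that event the sum is constant.
\<close>

lemma mode_atom:
  assumes c: "c > 0" and le: "\<And>n. c \<le> (\<Prod>i<n. mode_prob i)"
  shows "\<exists>x. prob {\<omega> \<in> space M. tail 0 \<omega> = x} > 0"
proof -
  define m where "m i = (if prob {\<omega> \<in> space M. X i \<omega> = 0} = mode_prob i then 0 else 1 :: real)" for i
  have m: "prob (X i -` {m i} \<inter> space M) = mode_prob i" for i
  proof -
    have "X i -` {y} \<inter> space M = {\<omega> \<in> space M. X i \<omega> = y}" for y by auto
    then show ?thesis by (auto simp: m_def mode_prob_def max_def)
  qed
  define E where "E n = {\<omega> \<in> space M. \<forall>i<n. X i \<omega> = m i}" for n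
  have E_sets [measurable]: "E n \<in> sets M" for n unfolding E_def by measurable
  have "c \<le> prob (E n)" for n
  proof (cases "n = 0")
    case True
    then show ?thesis using le[of 0] by (simp add: E_def prob_space)
  next
    case False
    then have "E n = (\<Inter>i\<in>{..<n}. X i -` {m i} \<inter> space M)" by (auto simp: E_def)
    moreover have "prob (\<Inter>i\<in>{..<n}. X i -` {m i} \<inter> space M) = (\<Prod>i<n. prob (X i -` {m i} \<inter> space M))"
      using False by (intro indep_varsD[OF indep]) (auto simp: lessThan_empty_iff)
    ultimately have "prob (E n) = (\<Prod>i<n. prob (X i -` {m i} \<inter> space M))"
      by simp
    then show ?thesis using le[of n] by (simp add: m)
  qed
  moreover have "(\<lambda>n. prob (E n)) \<longlonglongrightarrow> prob (\<Inter>n. E n)"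
    by (intro finite_Lim_measure_decseq) (auto simp: E_def decseq_def)
  ultimately have "c \<le> prob (\<Inter>n. E n)"
    by (intro LIMSEQ_le_const) auto
  also have "\<dots> \<le> prob {\<omega> \<in> space M. tail 0 \<omega> = (\<Sum>i. a i * m i)}"
  proof (intro finite_measure_mono subsetI)
    fix \<omega> assume "\<omega> \<in> (\<Inter>n. E n)"
    then have E: "\<omega> \<in> E n" for n by blast
    then have "\<omega> \<in> space M" by (simp add: E_def)
    moreover have "X i \<omega> = m i" for i using E[of "Suc i"] by (simp add: E_def)
    ultimately show "\<omega> \<in> {\<omega> \<in> space M. tail 0 \<omega> = (\<Sum>i. a i * m i)}"
      by (simp add: tail_def)
  qed auto
  finally show ?thesis using c by (intro exI) (rule less_le_trans)
qed

lemma concentration_bdd: "bdd_above (range (\<lambda>y. prob {\<omega> \<in> space M. tail n \<omega> = y}))"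
  by (rule bdd_aboveI[where M=1]) auto

lemma atom_le_concentration: "prob {\<omega> \<in> space M. tail n \<omega> = y} \<le> concentration n"
  unfolding concentration_def by (rule cSUP_upper[OF _ concentration_bdd]) simp

lemma concentration_le_1: "concentration n \<le> 1"
  unfolding concentration_def by (rule cSUP_least) auto

lemma tail_atom_split:
  "prob {\<omega> \<in> space M. tail n \<omega> = y} =
     prob {\<omega> \<in> space M. X n \<omega> = 0} * prob {\<omega> \<in> space M. tail (Suc n) \<omega> = y} +
     prob {\<omega> \<in> space M. X n \<omega> = 1} * prob {\<omega> \<in> space M. tail (Suc n) \<omega> = y - a n}"
proof -
  have ind: "indep_var borel (X n) borel (tail (Suc n))"
    using indep_prefix_tail[of "{n}" "Suc n" "\<lambda>x. x n"] by simp
  have prod: "prob {\<omega> \<in> space M. X n \<omega> = u \<and> tail (Suc n) \<omega> = v}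
      = prob {\<omega> \<in> space M. X n \<omega> = u} * prob {\<omega> \<in> space M. tail (Suc n) \<omega> = v}" for u v
    using indep_varD[OF ind, of "{u}" "{v}"]
    by (simp add: vimage_def Int_def conj_commute)
  have "{\<omega> \<in> space M. tail n \<omega> = y} =
      {\<omega> \<in> space M. X n \<omega> = 0 \<and> tail (Suc n) \<omega> = y} \<union>
      {\<omega> \<in> space M. X n \<omega> = 1 \<and> tail (Suc n) \<omega> = y - a n}"
    by (auto simp: tail_Suc[of n]) (metis X_01 mult_zero_right mult.right_neutral add_0 add_diff_cancel_left')+
  then have "prob {\<omega> \<in> space M. tail n \<omega> = y} =
      prob {\<omega> \<in> space M. X n \<omega> = 0 \<and> tail (Suc n) \<omega> = y} +
      prob {\<omega> \<in> space M. X n \<omega> = 1 \<and> tail (Suc n) \<omega> = y - a n}"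
    by (simp only:) (rule finite_measure_Union; auto)
  then show ?thesis by (simp add: prod)
qed

lemma concentration_mono: "concentration n \<le> concentration (Suc n)"
  unfolding concentration_def[of n]
proof (rule cSUP_least)
  fix y
  have "prob {\<omega> \<in> space M. tail n \<omega> = y} \<le>
      prob {\<omega> \<in> space M. X n \<omega> = 0} * concentration (Suc n) + prob {\<omega> \<in> space M. X n \<omega> = 1} * concentration (Suc n)"
    unfolding tail_atom_split[of n y] by (intro add_mono mult_left_mono atom_le_concentration) auto
  also have "\<dots> = concentration (Suc n)"
    unfolding distrib_right[symmetric] prob_X by simp
  finally show "prob {\<omega> \<in> space M. tail n \<omega> = y} \<le> concentration (Suc n)" .
qed simp

text \<open>
  An atom of \<open>tail n\<close> is a mixture, with the weights of the digit, of the probabilities of two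
  distinct values of \<open>tail (Suc n)\<close>. Both are at most the concentration \<open>Q\<close> of
  \<open>tail (Suc n)\<close> and their sum is at most 1, so with \<open>D\<close> the larger weight the mixture
  is at most \<open>D * Q + (1 - D) * (1 - Q)\<close>. The stated form is this bound rescaled so that it
  can be multiplied along \<open>n\<close>.
\<close>

lemma concentration_step:
  assumes "a n \<noteq> 0"
  shows "2 * concentration n - 1 \<le> (2 * mode_prob n - 1) * (2 * concentration (Suc n) - 1)"
proof -
  define u where "u y = prob {\<omega> \<in> space M. tail (Suc n) \<omega> = y}" for y
  define p0 where "p0 = prob {\<omega> \<in> space M. X n \<omega> = 0}"
  define p1 where "p1 = prob {\<omega> \<in> space M. X n \<omega> = 1}"
  define D where "D = mode_prob n"
  define Q where "Q = concentration (Suc n)"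
  have u: "u y \<le> Q" for y unfolding u_def Q_def by (rule atom_le_concentration)
  have p: "p0 + p1 = 1" unfolding p0_def p1_def by (rule prob_X)
  have D: "D = max p0 p1" by (simp add: D_def mode_prob_def p0_def p1_def)
  have "concentration n \<le> D * Q + (1 - D) * (1 - Q)"
    unfolding concentration_def[of n]
  proof (rule cSUP_least)
    fix y
    have "u y + u (y - a n) = prob ({\<omega> \<in> space M. tail (Suc n) \<omega> = y} \<union>
        {\<omega> \<in> space M. tail (Suc n) \<omega> = y - a n})"
      unfolding u_def using assms by (intro finite_measure_Union[symmetric]) auto
    then have le1: "u y + u (y - a n) \<le> 1" by simp
    \<comment> \<open>The mixture grows with the weight on the larger probability, then with the smaller
      probability up to its bound \<open>1 - hi\<close>, and then, since \<open>D\<close> is at least 1/2,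
      with the larger probability up to its bound \<open>Q\<close>.\<close>
    have conv: "d * s + (1 - d) * t \<le> D * Q + (1 - D) * (1 - Q)"
      if "s \<le> Q" "t \<le> Q" "s + t \<le> 1" "d \<le> D" "1 - d \<le> D" for d s t
    proof -
      define hi where "hi = max s t"
      have "d * s + (1 - d) * t \<le> D * hi + (1 - D) * (s + t - hi)"
      proof (cases "t \<le> s")
        case True
        then have "0 \<le> (D - d) * (s - t)" using that by simp
        then show ?thesis using True by (simp add: hi_def max_def algebra_simps)
      next
        case False
        then have "0 \<le> (D - (1 - d)) * (t - s)" using that by (intro mult_nonneg_nonneg) auto
        then show ?thesis using False by (simp add: hi_def max_def algebra_simps)
      qed
      also have "\<dots> \<le> D * hi + (1 - D) * (1 - hi)"
        using that mode_prob_bounds[of n] by (intro add_left_mono mult_left_mono) (auto simp: D_def)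
      also have "\<dots> \<le> D * Q + (1 - D) * (1 - Q)"
      proof -
        have "0 \<le> (2 * D - 1) * (Q - hi)"
          using that mode_prob_bounds[of n] by (intro mult_nonneg_nonneg) (auto simp: D_def hi_def)
        then show ?thesis by (simp add: algebra_simps)
      qed
      finally show ?thesis .
    qed
    have "p1 = 1 - p0" using p by simp
    then have "prob {\<omega> \<in> space M. tail n \<omega> = y} = p0 * u y + (1 - p0) * u (y - a n)"
      using tail_atom_split[of n y] by (simp add: u_def p0_def p1_def)
    also have "\<dots> \<le> D * Q + (1 - D) * (1 - Q)"
      using u le1 p by (intro conv) (auto simp: D)
    finally show "prob {\<omega> \<in> space M. tail n \<omega> = y} \<le> D * Q + (1 - D) * (1 - Q)" .
  qed simp
  then have "2 * concentration n - 1 \<le> (2 * D - 1) * (2 * Q - 1)" by (simp add: algebra_simps)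
  then show ?thesis by (simp add: D_def Q_def)
qed

text \<open>
  The event that the sum equals \<open>c\<close> is approximated from outside by events \<open>F n\<close> that
  depend on the first \<open>n\<close> digits only: the partial sum is within the largest possible
  remainder \<open>r n\<close> of \<open>c\<close>. Given \<open>F n\<close>, the probability of the value \<open>c\<close>
  tends to 1 because the \<open>F n\<close> decrease to the event; and it is at most the concentration of
  the remainder, which is independent of \<open>F n\<close>.
\<close>

lemma concentration_gt_half:
  assumes pos: "prob {\<omega> \<in> space M. tail 0 \<omega> = c} > 0"
  shows "\<exists>n. concentration n > 1 / 2"
proof -
  define r where "r n = (\<Sum>i. \<bar>a (i + n)\<bar>)" for n
  define S where "S n \<omega> = (\<Sum>i<n. a i * X i \<omega>)" for n \<omega>
  define F where "F n = {\<omega> \<in> space M. S n \<omega> \<in> {c - r n .. c + r n}}" for n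
  have S_measurable [measurable]: "S n \<in> borel_measurable M" for n
    unfolding S_def[abs_def] by measurable
  have F_sets: "F n \<in> sets M" for n unfolding F_def by measurable
  have indep_S: "indep_var borel (S n) borel (tail n)" for n
    using indep_prefix_tail[of "{..<n}" n "\<lambda>x. \<Sum>i<n. a i * x i"] by (simp add: S_def[abs_def])
  have r_tendsto: "r \<longlonglongrightarrow> 0"
    unfolding r_def[abs_def] by (rule suminf_exist_split2[OF summable_abs])
  have r_Suc: "r n = \<bar>a n\<bar> + r (Suc n)" for n
    using suminf_split_head[OF summable_abs[THEN summable_ignore_initial_segment[of _ n]]]
    by (simp add: r_def)
  have "decseq F"
  proof (rule decseq_SucI, rule subsetI)
    fix n \<omega> assume "\<omega> \<in> F (Suc n)"
    then show "\<omega> \<in> F n"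
      using term_le[of n \<omega>] by (auto simp: F_def S_def r_Suc[of n])
  qed
  moreover have "(\<Inter>n. F n) = {\<omega> \<in> space M. tail 0 \<omega> = c}"
  proof (intro set_eqI iffI)
    fix \<omega> assume "\<omega> \<in> (\<Inter>n. F n)"
    then have F: "\<omega> \<in> F n" for n by blast
    then have sp: "\<omega> \<in> space M" by (simp add: F_def)
    have "\<bar>S n \<omega> - c\<bar> \<le> r n" for n using F[of n] by (auto simp: F_def abs_le_iff)
    then have "(\<lambda>n. S n \<omega> - c) \<longlonglongrightarrow> 0"
      by (intro Lim_null_comparison[OF _ r_tendsto]) simp
    moreover have "(\<lambda>n. S n \<omega>) \<longlonglongrightarrow> tail 0 \<omega>"
      using summable_LIMSEQ[OF summable_terms[of 0 \<omega>]] by (simp add: S_def[abs_def] tail_def)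
    ultimately have "tail 0 \<omega> = c"
      by (metis LIMSEQ_unique Lim_null)
    with sp show "\<omega> \<in> {\<omega> \<in> space M. tail 0 \<omega> = c}" by simp
  next
    fix \<omega> assume "\<omega> \<in> {\<omega> \<in> space M. tail 0 \<omega> = c}"
    then have \<omega>: "\<omega> \<in> space M" "tail 0 \<omega> = c" by auto
    have "S n \<omega> \<in> {c - r n .. c + r n}" for n
      using abs_tail_le[of n \<omega>] tail_split[of \<omega> n] \<omega>(2)
      unfolding S_def r_def atLeastAtMost_iff by linarith
    with \<omega>(1) show "\<omega> \<in> (\<Inter>n. F n)" by (simp add: F_def)
  qed
  ultimately have "(\<lambda>n. prob (F n)) \<longlonglongrightarrow> prob {\<omega> \<in> space M. tail 0 \<omega> = c}"
    using finite_Lim_measure_decseq[of F] F_sets by (simp add: image_subset_iff)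
  then have "eventually (\<lambda>n. prob (F n) < 2 * prob {\<omega> \<in> space M. tail 0 \<omega> = c}) sequentially"
    using pos by (intro order_tendstoD(2)) auto
  then obtain n where n: "prob (F n) < 2 * prob {\<omega> \<in> space M. tail 0 \<omega> = c}"
    by (auto dest: eventually_happens)
  have "{\<omega> \<in> space M. tail 0 \<omega> = c} \<subseteq>
      {\<omega> \<in> space M. S n \<omega> \<in> {c - r n .. c + r n} \<and> S n \<omega> + tail n \<omega> = c}"
    using \<open>(\<Inter>n. F n) = _\<close> tail_split[of _ n] by (auto simp: F_def S_def)
  then have "prob {\<omega> \<in> space M. tail 0 \<omega> = c} \<le>
      prob {\<omega> \<in> space M. S n \<omega> \<in> {c - r n .. c + r n} \<and> S n \<omega> + tail n \<omega> = c}"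
    by (intro finite_measure_mono) auto
  also have "\<dots> \<le> concentration n * prob (F n)"
    unfolding F_def S_def
    by (intro indep_sum_atom_le indep_S[unfolded S_def[abs_def]] atom_le_concentration) auto
  finally have le: "prob {\<omega> \<in> space M. tail 0 \<omega> = c} \<le> concentration n * prob (F n)" .
  show ?thesis
  proof (intro exI[of _ n], rule ccontr)
    assume "\<not> concentration n > 1 / 2"
    then have "concentration n * prob (F n) \<le> 1 / 2 * prob (F n)"
      by (intro mult_right_mono) auto
    with le n show False by simp
  qed
qed

text \<open>
  From an index \<open>m\<close> with concentration above 1/2 onwards, \<open>concentration_step\<close>
  telescopes multiplicatively; each of the finitely many earlier factors is at least 1/2.
\<close>

lemma mode_product_bounded_below:
  assumes nz: "\<And>n. a n \<noteq> 0" and pos: "prob {\<omega> \<in> space M. tail 0 \<omega> = x} > 0"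
  shows "\<exists>c>0. \<forall>n. c \<le> (\<Prod>i<n. mode_prob i)"
proof -
  obtain m where m: "concentration m > 1 / 2" using concentration_gt_half[OF pos] by blast
  have concentration_ge: "concentration (m + k) > 1 / 2" for k
    by (induction k) (use m concentration_mono in \<open>auto intro: less_le_trans\<close>)
  have step: "2 * concentration m - 1 \<le> (\<Prod>i<k. mode_prob (m + i)) * (2 * concentration (m + k) - 1)" for k
  proof (induction k)
    case (Suc k)
    have "2 * concentration (m + k) - 1 \<le> (2 * mode_prob (m + k) - 1) * (2 * concentration (m + Suc k) - 1)"
      using concentration_step[OF nz, of "m + k"] by simp
    also have "\<dots> \<le> mode_prob (m + k) * (2 * concentration (m + Suc k) - 1)"
      using mode_prob_bounds[of "m + k"] concentration_ge[of "Suc k"] by (intro mult_right_mono) auto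
    finally have "(\<Prod>i<k. mode_prob (m + i)) * (2 * concentration (m + k) - 1) \<le>
        (\<Prod>i<k. mode_prob (m + i)) * (mode_prob (m + k) * (2 * concentration (m + Suc k) - 1))"
      by (intro mult_left_mono prod_nonneg) (auto simp: mode_prob_def le_max_iff_disj)
    with Suc show ?case by (simp add: mult.assoc)
  qed simp
  have pnn: "0 \<le> mode_prob i" for i using mode_prob_bounds[of i] by simp
  have tail_prod: "2 * concentration m - 1 \<le> (\<Prod>i<k. mode_prob (m + i))" for k
  proof -
    have "(\<Prod>i<k. mode_prob (m + i)) * (2 * concentration (m + k) - 1) \<le> (\<Prod>i<k. mode_prob (m + i)) * 1"
      using concentration_le_1[of "m + k"] pnn by (intro mult_left_mono prod_nonneg) auto
    with step[of k] show ?thesis by simp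
  qed
  have "(1 / 2) ^ m * (2 * concentration m - 1) \<le> (\<Prod>i<n. mode_prob i)" for n
  proof -
    have "(1 / 2) ^ m = (\<Prod>i<m. 1 / 2 :: real)" by simp
    also have "\<dots> \<le> (\<Prod>i<m. mode_prob i)"
      using mode_prob_bounds by (intro prod_mono) auto
    finally have "(1 / 2) ^ m * (2 * concentration m - 1) \<le> (\<Prod>i<m. mode_prob i) * (\<Prod>i<n. mode_prob (m + i))"
      using m pnn by (intro mult_mono tail_prod prod_nonneg) auto
    also have "\<dots> = (\<Prod>i<m + n. mode_prob i)"
      by (induction n) (auto simp: mult.assoc)
    also have "\<dots> \<le> (\<Prod>i<n. mode_prob i)"
      using pnn mode_prob_bounds
      by (induction m) (auto intro: order_trans[OF mult_right_le_one_le] prod_nonneg)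
    finally show ?thesis .
  qed
  moreover have "0 < (1 / 2) ^ m * (2 * concentration m - 1)" using m by simp
  ultimately show ?thesis by blast
qed

lemma atom_if_purely_discrete:
  assumes "purely_discrete (distr M borel (tail 0))"
  shows "\<exists>x. prob {\<omega> \<in> space M. tail 0 \<omega> = x} > 0"
proof (rule ccontr)
  interpret D: prob_space "distr M borel (tail 0)" by (rule prob_space_distr) simp
  assume "\<not> ?thesis"
  then have z: "prob {\<omega> \<in> space M. tail 0 \<omega> = x} = 0" for x
    using measure_nonneg[of M] by (metis less_eq_real_def)
  obtain A where A: "countable A" "AE x in distr M borel (tail 0). x \<in> A"
    using assms by (auto simp: purely_discrete_def)
  have "(\<Union>x\<in>A. {x}) \<in> null_sets (distr M borel (tail 0))"
    using A(1) by (intro null_sets_UN') (auto intro!: null_setsI simp: emeasure_distr_tail z)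
  then have "AE x in distr M borel (tail 0). x \<notin> A" using AE_not_in by fastforce
  with A(2) have "AE x in distr M borel (tail 0). False" by eventually_elim simp
  then show False by simp
qed

theorem purely_discrete_iff:
  assumes "\<And>n. a n \<noteq> 0"
  shows "purely_discrete (distr M borel (tail 0)) \<longleftrightarrow> (\<exists>c>0. \<forall>n. c \<le> (\<Prod>i<n. mode_prob i))"
  using atom_if_purely_discrete mode_product_bounded_below[OF assms] mode_atom purely_discrete_if_atom
  by meson

end

section \<open>Iterated infinite products\<close>

lemma inf_product_tendsto:
  assumes f: "\<And>k. k \<ge> 1 \<Longrightarrow> 0 \<le> f k \<and> f k \<le> 1"
  shows "(\<lambda>n. \<Prod>k=1..n. f k) \<longlonglongrightarrow> inf_product f"
    and "inf_product f \<le> (\<Prod>k=1..n. f k)"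
    and "0 \<le> inf_product f" and "inf_product f \<le> 1"
proof -
  have nonneg: "0 \<le> (\<Prod>k=1..n. f k)" for n using f by (intro prod_nonneg) auto
  have dec: "decseq (\<lambda>n. \<Prod>k=1..n. f k)"
    using f nonneg by (intro decseq_SucI) (auto intro!: mult_right_le_one_le)
  then have "convergent (\<lambda>n. \<Prod>k=1..n. f k)"
    using nonneg by (intro Bseq_monoseq_convergent) (auto intro: decseq_bounded[of _ 0] simp: decseq_imp_monoseq)
  then show lim: "(\<lambda>n. \<Prod>k=1..n. f k) \<longlonglongrightarrow> inf_product f"
    by (simp add: inf_product_def convergent_LIMSEQ_iff)
  show le: "inf_product f \<le> (\<Prod>k=1..n. f k)" for n
    using decseq_ge[OF dec lim] by simp
  show "0 \<le> inf_product f" using nonneg by (intro LIMSEQ_le_const[OF lim]) auto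
  show "inf_product f \<le> 1" using le[of 0] by simp
qed

lemma prod_antimono:
  fixes f :: "'i \<Rightarrow> real"
  assumes "finite B" "A \<subseteq> B" "\<And>i. i \<in> B \<Longrightarrow> 0 \<le> f i \<and> f i \<le> 1"
  shows "prod f B \<le> prod f A"
proof -
  have "prod f B = prod f (B - A) * prod f A"
    using assms by (intro prod.subset_diff) auto
  also have "\<dots> \<le> prod f A"
    using assms by (intro mult_left_le_one_le prod_nonneg prod_le_1) auto
  finally show ?thesis .
qed

text \<open>
  For factors in \<open>[0, 1]\<close> every finite partial product dominates all larger ones, so
  positivity of either infinite product means a positive lower bound for the products over finite
  sets of index pairs. Rectangles and initial segments of the enumeration are both cofinal among
  these sets.
\<close>

lemma iterated_inf_product_pos_iff:
  fixes f :: "nat \<Rightarrow> nat \<Rightarrow> real"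
  assumes f: "\<And>j k. j \<ge> 1 \<Longrightarrow> k \<ge> 1 \<Longrightarrow> 0 \<le> f j k \<and> f j k \<le> 1"
  shows "inf_product (\<lambda>j. inf_product (f j)) > 0 \<longleftrightarrow>
    (\<exists>c>0. \<forall>n. c \<le> (\<Prod>i<n. case prod_decode i of (j, k) \<Rightarrow> f (Suc j) (Suc k)))"
proof -
  define g where "g = (\<lambda>(j, k). f (Suc j) (Suc k))"
  have g01: "0 \<le> g x \<and> g x \<le> 1" for x using f by (cases x) (auto simp: g_def)
  have enum: "(\<Prod>i<n. case prod_decode i of (j, k) \<Rightarrow> f (Suc j) (Suc k)) = prod g (prod_decode ` {..<n})" for n
    by (subst prod.reindex) (auto simp: inj_prod_decode g_def)
  have box: "prod g ({..<J} \<times> {..<K}) = (\<Prod>j=1..J. \<Prod>k=1..K. f j k)" for J K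
    unfolding g_def prod.cartesian_product[symmetric] by (simp add: prod.atLeast1_atMost_eq)
  have row: "0 \<le> inf_product (f j) \<and> inf_product (f j) \<le> 1" if "j \<ge> 1" for j
    using inf_product_tendsto(3,4)[of "f j"] f that by auto
  show ?thesis
  proof
    assume pos: "inf_product (\<lambda>j. inf_product (f j)) > 0"
    have "inf_product (\<lambda>j. inf_product (f j)) \<le> prod g (prod_decode ` {..<n})" for n
    proof -
      have fin: "finite (prod_decode ` {..<n})" by simp
      obtain J where J: "fst ` prod_decode ` {..<n} \<subseteq> {..<J}"
        using finite_nat_iff_bounded[of "fst ` prod_decode ` {..<n}"] by auto
      obtain K where K: "snd ` prod_decode ` {..<n} \<subseteq> {..<K}"
        using finite_nat_iff_bounded[of "snd ` prod_decode ` {..<n}"] by auto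
      have "inf_product (\<lambda>j. inf_product (f j)) \<le> (\<Prod>j=1..J. inf_product (f j))"
        by (rule inf_product_tendsto) (rule row)
      also have "\<dots> \<le> (\<Prod>j=1..J. \<Prod>k=1..K. f j k)"
      proof (intro prod_mono conjI)
        fix j assume "j \<in> {1..J}"
        then show "0 \<le> inf_product (f j)" "inf_product (f j) \<le> (\<Prod>k=1..K. f j k)"
          using row f by (simp, intro inf_product_tendsto(2)) auto
      qed
      also have "\<dots> = prod g ({..<J} \<times> {..<K})" by (simp only: box)
      also have "\<dots> \<le> prod g (prod_decode ` {..<n})"
        using J K g01 by (intro prod_antimono) (auto simp: image_subset_iff mem_Times_iff)
      finally show ?thesis .
    qed
    with pos show "\<exists>c>0. \<forall>n. c \<le> (\<Prod>i<n. case prod_decode i of (j, k) \<Rightarrow> f (Suc j) (Suc k))"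
      unfolding enum by blast
  next
    assume "\<exists>c>0. \<forall>n. c \<le> (\<Prod>i<n. case prod_decode i of (j, k) \<Rightarrow> f (Suc j) (Suc k))"
    then obtain c where c: "c > 0" "\<And>n. c \<le> prod g (prod_decode ` {..<n})"
      unfolding enum by blast
    have "c \<le> (\<Prod>j=1..J. \<Prod>k=1..K. f j k)" for J K
    proof -
      obtain n where n: "prod_encode ` ({..<J} \<times> {..<K}) \<subseteq> {..<n}"
        using finite_nat_iff_bounded[of "prod_encode ` ({..<J} \<times> {..<K})"] by auto
      have "{..<J} \<times> {..<K} \<subseteq> prod_decode ` {..<n}"
      proof
        fix x assume "x \<in> {..<J} \<times> {..<K}"
        with n have "prod_encode x \<in> {..<n}" by blast
        then show "x \<in> prod_decode ` {..<n}" by (metis imageI prod_encode_inverse)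
      qed
      then have "prod g (prod_decode ` {..<n}) \<le> prod g ({..<J} \<times> {..<K})"
        using g01 by (intro prod_antimono) auto
      with c(2)[of n] show ?thesis by (simp only: box)
    qed
    moreover have "(\<lambda>K. \<Prod>j=1..J. \<Prod>k=1..K. f j k) \<longlonglongrightarrow> (\<Prod>j=1..J. inf_product (f j))" for J
      using f by (intro tendsto_prod inf_product_tendsto(1)) auto
    ultimately have "c \<le> (\<Prod>j=1..J. inf_product (f j))" for J
      by (meson LIMSEQ_le_const)
    moreover have "(\<lambda>J. \<Prod>j=1..J. inf_product (f j)) \<longlonglongrightarrow> inf_product (\<lambda>j. inf_product (f j))"
      by (rule inf_product_tendsto(1)) (rule row)
    ultimately have "c \<le> inf_product (\<lambda>j. inf_product (f j))"
      by (intro LIMSEQ_le_const) auto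
    with c(1) show "inf_product (\<lambda>j. inf_product (f j)) > 0" by simp
  qed
qed

section \<open>Absolute convergence of the double series\<close>

lemma summable_prod_decode:
  fixes h :: "nat \<times> nat \<Rightarrow> real"
  shows "(\<lambda>x. \<bar>h x\<bar>) summable_on UNIV \<longleftrightarrow> summable (\<lambda>i. \<bar>h (prod_decode i)\<bar>)"
  using summable_on_reindex_bij_betw[OF bij_prod_decode, of "\<lambda>x. \<bar>h x\<bar>"]
    summable_on_UNIV_nonneg_real_iff[of "\<lambda>i. \<bar>h (prod_decode i)\<bar>"] by simp

lemma suminf_prod_decode:
  fixes h :: "nat \<times> nat \<Rightarrow> real"
  assumes "summable (\<lambda>i. \<bar>h (prod_decode i)\<bar>)"
  shows "(\<Sum>j. \<Sum>k. h (j, k)) = (\<Sum>i. h (prod_decode i))"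
proof -
  have abs: "(\<lambda>x. \<bar>h x\<bar>) summable_on UNIV"
    using assms by (simp add: summable_prod_decode)
  then have "h summable_on UNIV" using abs_summable_summable[of h UNIV] by simp
  then have S: "(h has_sum infsum h UNIV) (Sigma UNIV (\<lambda>_. UNIV))"
    by simp
  have "((\<lambda>k. h (j, k)) has_sum (\<Sum>k. h (j, k))) UNIV" for j
  proof -
    have "(\<lambda>x. \<bar>h x\<bar>) summable_on (Pair j ` UNIV)"
      using abs by (rule summable_on_subset_banach) simp
    then have "(\<lambda>k. \<bar>h (j, k)\<bar>) summable_on UNIV"
      by (subst (asm) summable_on_reindex) (auto simp: o_def inj_on_def)
    then have "summable (\<lambda>k. \<bar>h (j, k)\<bar>)" by (rule summable_on_imp_summable)
    then show ?thesis
      using summable_sums[OF summable_rabs_cancel] by (intro norm_summable_imp_has_sum) simp_all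
  qed
  from has_sum_SigmaD[OF S this] have "(\<Sum>j. \<Sum>k. h (j, k)) = infsum h UNIV"
    by (intro sums_unique[symmetric] has_sum_imp_sums)
  moreover have "((\<lambda>i. h (prod_decode i)) has_sum infsum h UNIV) UNIV"
    using S by (simp add: has_sum_reindex_bij_betw[OF bij_prod_decode])
  then have "(\<Sum>i. h (prod_decode i)) = infsum h UNIV"
    by (intro sums_unique[symmetric] has_sum_imp_sums)
  ultimately show ?thesis by simp
qed

text \<open>
  The factor \<open>q k + 1\<close> in the growth condition is at least 2, so the reciprocals decay at
  least geometrically and every row is controlled by its first entry.
\<close>

lemma ostrogradsky_denominator_growth:
  fixes q :: "nat \<Rightarrow> nat"
  assumes "\<And>k. k \<ge> 1 \<Longrightarrow> q k > 0" "\<And>k. k \<ge> 1 \<Longrightarrow> q (k + 1) \<ge> q k * (q k + 1)"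
  shows "1 / real (q (Suc k)) \<le> (1 / 2) ^ k * (1 / real (q 1))"
proof -
  have "q 1 * 2 ^ k \<le> q (Suc k)"
  proof (induction k)
    case (Suc k)
    have "q 1 * 2 ^ Suc k \<le> q (Suc k) * 2" using Suc by simp
    also have "\<dots> \<le> q (Suc k) * (q (Suc k) + 1)" using assms(1)[of "Suc k"] by (intro mult_left_mono) auto
    also have "\<dots> \<le> q (Suc (Suc k))" using assms(2)[of "Suc k"] by simp
    finally show ?case .
  qed simp
  then have "real (q 1) * 2 ^ k \<le> real (q (Suc k))"
    by (metis of_nat_le_iff of_nat_mult of_nat_numeral of_nat_power)
  moreover have "0 < real (q 1)" using assms(1)[of 1] by simp
  ultimately have "1 / real (q (Suc k)) \<le> 1 / (real (q 1) * 2 ^ k)"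
    by (intro frac_le) auto
  then show ?thesis by (simp add: power_divide mult.commute)
qed

lemma summable_ostrogradsky_terms:
  fixes q :: "nat \<Rightarrow> nat \<Rightarrow> nat"
  assumes pos: "\<And>j k. j \<ge> 1 \<Longrightarrow> k \<ge> 1 \<Longrightarrow> q j k > 0"
    and growth: "\<And>j k. j \<ge> 1 \<Longrightarrow> k \<ge> 1 \<Longrightarrow> q j (k + 1) \<ge> q j k * (q j k + 1)"
    and sum: "summable (\<lambda>j. 1 / real (q (Suc j) 1))"
  shows "summable (\<lambda>i. case prod_decode i of (j, k) \<Rightarrow> 1 / real (q (Suc j) (Suc k)))"
proof -
  define b where "b j = 1 / real (q (Suc j) 1)" for j
  have "((\<lambda>k. case (j, k) of (j, k) \<Rightarrow> (1 / 2) ^ k * b j) has_sum 2 * b j) UNIV" for j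
    using norm_summable_imp_has_sum[of "\<lambda>k. (1 / 2) ^ k * b j" "2 * b j"]
      sums_mult2[OF geometric_sums[of "1 / 2 :: real"], of "b j"]
    by (simp add: abs_mult summable_mult2 summable_geometric)
  moreover have "(\<lambda>j. 2 * b j) summable_on UNIV"
    using summable_mult[OF sum, of 2] by (intro norm_summable_imp_summable_on) (simp add: b_def)
  ultimately have "(\<lambda>(j, k). (1 / 2) ^ k * b j) summable_on (Sigma UNIV (\<lambda>_. UNIV))"
    by (rule summable_on_SigmaI) (auto simp: b_def)
  then have "(\<lambda>(j, k). (1 / 2) ^ k * b j) summable_on UNIV" by simp
  then have "(\<lambda>(j, k). 1 / real (q (Suc j) (Suc k))) summable_on UNIV"
  proof (rule summable_on_comparison_test)
    fix x :: "nat \<times> nat"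
    show "(case x of (j, k) \<Rightarrow> 1 / real (q (Suc j) (Suc k))) \<le> (case x of (j, k) \<Rightarrow> (1 / 2) ^ k * b j)"
      using ostrogradsky_denominator_growth[of "q (Suc (fst x))" "snd x"] pos growth
      by (simp add: b_def case_prod_unfold)
  qed (simp add: case_prod_unfold)
  then have "(\<lambda>x. \<bar>case x of (j, k) \<Rightarrow> 1 / real (q (Suc j) (Suc k))\<bar>) summable_on UNIV"
    by (simp add: case_prod_unfold)
  then show ?thesis
    unfolding summable_prod_decode by (simp add: case_prod_unfold)
qed

section \<open>The distribution of the Ostrogradsky sum\<close>

theorem theorem5:
  fixes M :: "'a measure"
    and q :: "nat \<Rightarrow> nat \<Rightarrow> nat"
    and \<xi> :: "nat \<Rightarrow> nat \<Rightarrow> 'a \<Rightarrow> real"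
    and p0 p1 :: "nat \<Rightarrow> nat \<Rightarrow> real"
  assumes "prob_space M"
    and "\<And>j k. j \<ge> 1 \<Longrightarrow> k \<ge> 1 \<Longrightarrow> q j k > 0"
    and "\<And>j k. j \<ge> 1 \<Longrightarrow> k \<ge> 1 \<Longrightarrow> q j (k + 1) \<ge> q j k * (q j k + 1)"
    and "\<And>k. k \<ge> 1 \<Longrightarrow> summable (\<lambda>j. 1 / real (q (Suc j) k))"
    and "prob_space.indep_vars M (\<lambda>_. borel) (\<lambda>(j, k). \<xi> j k) ({1..} \<times> {1..})"
    and "\<And>j k. j \<ge> 1 \<Longrightarrow> k \<ge> 1 \<Longrightarrow> p0 j k \<ge> 0 \<and> p1 j k \<ge> 0 \<and> p0 j k + p1 j k = 1"
    and "\<And>j k. j \<ge> 1 \<Longrightarrow> k \<ge> 1 \<Longrightarrow> measure M {\<omega> \<in> space M. \<xi> j k \<omega> = 0} = p0 j k"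
    and "\<And>j k. j \<ge> 1 \<Longrightarrow> k \<ge> 1 \<Longrightarrow> measure M {\<omega> \<in> space M. \<xi> j k \<omega> = 1} = p1 j k"
  shows "pure_type (distr M borel (ostrogradsky_sum q \<xi>)) \<and>
    (purely_discrete (distr M borel (ostrogradsky_sum q \<xi>)) \<longleftrightarrow>
     inf_product (\<lambda>j. inf_product (\<lambda>k. max (p0 j k) (p1 j k))) > 0)"
proof -
  interpret prob_space M by fact
  note q_pos = assms(2) and p_sum = assms(6) and prob_0 = assms(7) and prob_1 = assms(8)
  define a where "a i = (case prod_decode i of (j, k) \<Rightarrow> (-1) ^ k / real (q (Suc j) (Suc k)))" for i
  define Y where "Y i = (case prod_decode i of (j, k) \<Rightarrow> \<xi> (Suc j) (Suc k))" for i
  \<comment> \<open>The given variables are zero-one valued only almost surely. The indicators of the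
    value 1 are so everywhere, and membership of the sum in an invariant set becomes a tail event
    exactly, not only up to a null set.\<close>
  define X where "X i \<omega> = (if Y i \<omega> = 1 then 1 else 0 :: real)" for i \<omega>
  have Y_indep: "indep_vars (\<lambda>_. borel) Y UNIV"
  proof -
    define e where "e i = (case prod_decode i of (j, k) \<Rightarrow> (Suc j, Suc k))" for i
    have "inj e"
      by (rule injI) (simp add: e_def case_prod_unfold prod_eq_iff[symmetric])
    \<comment> \<open>Reindexing an independent family is grouping it into singletons.\<close>
    then have "disjoint_family_on (\<lambda>i. {e i}) UNIV"
      by (auto simp: disjoint_family_on_def dest: injD)
    moreover have "{e i} \<subseteq> {1..} \<times> {1..}" for i by (simp add: e_def case_prod_unfold)
    ultimately have "indep_vars (\<lambda>i. PiM {e i} (\<lambda>_. borel)) (\<lambda>i \<omega>. \<lambda>jk\<in>{e i}. (\<lambda>(j, k). \<xi> j k) jk \<omega>) UNIV"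
      by (intro indep_vars_restrict[OF assms(5)])
    then have "indep_vars (\<lambda>_. borel) (\<lambda>i \<omega>. (\<lambda>jk\<in>{e i}. (\<lambda>(j, k). \<xi> j k) jk \<omega>) (e i)) UNIV"
      by (rule indep_vars_compose2) measurable
    then show ?thesis
      by (simp add: Y_def[abs_def] e_def case_prod_unfold)
  qed
  have [measurable]: "Y i \<in> borel_measurable M" for i
    using Y_indep by (auto simp: indep_vars_def)
  have abs_a: "\<bar>a i\<bar> = (case prod_decode i of (j, k) \<Rightarrow> 1 / real (q (Suc j) (Suc k)))" for i
    by (simp add: a_def case_prod_unfold power_abs)
  interpret S: bernoulli_series M a X
  proof
    show "indep_vars (\<lambda>_. borel) X UNIV"
      using indep_vars_compose2[OF Y_indep, of "\<lambda>_ y. if y = 1 then 1 else 0 :: real" "\<lambda>_. borel"]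
      by (simp add: X_def[abs_def])
    show "summable (\<lambda>n. \<bar>a n\<bar>)"
      unfolding abs_a using assms(2,3,4) by (intro summable_ostrogradsky_terms) auto
  qed (auto simp: X_def)
  have prob_Y: "prob {\<omega> \<in> space M. Y i \<omega> = 0} = (case prod_decode i of (j, k) \<Rightarrow> p0 (Suc j) (Suc k))"
    "prob {\<omega> \<in> space M. Y i \<omega> = 1} = (case prod_decode i of (j, k) \<Rightarrow> p1 (Suc j) (Suc k))" for i
    by (auto simp: Y_def prob_0 prob_1 split: prod.splits)
  have prob_Y_sum: "prob {\<omega> \<in> space M. Y i \<omega> = 0} + prob {\<omega> \<in> space M. Y i \<omega> = 1} = 1" for i
    unfolding prob_Y using p_sum by (auto split: prod.splits)
  have X_eq_Y: "AE \<omega> in M. \<forall>i. X i \<omega> = Y i \<omega>"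
  proof (subst AE_all_countable, rule allI)
    fix i
    have "prob {\<omega> \<in> space M. Y i \<omega> = 0 \<or> Y i \<omega> = 1} =
        prob ({\<omega> \<in> space M. Y i \<omega> = 0} \<union> {\<omega> \<in> space M. Y i \<omega> = 1})"
      by (intro arg_cong[where f=prob]) auto
    also have "\<dots> = 1"
      by (subst finite_measure_Union) (auto simp: prob_Y_sum)
    finally have "AE \<omega> in M. Y i \<omega> = 0 \<or> Y i \<omega> = 1"
      by (subst (asm) prob_Collect_eq_1) auto
    then show "AE \<omega> in M. X i \<omega> = Y i \<omega>" by eventually_elim (auto simp: X_def)
  qed
  have sum_eq: "ostrogradsky_sum q \<xi> \<omega> = S.tail 0 \<omega>" if "\<forall>i. X i \<omega> = Y i \<omega>" for \<omega>
  proof -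
    define h where "h = (\<lambda>(j, k). (-1) ^ (Suc k + 1) * \<xi> (Suc j) (Suc k) \<omega> / real (q (Suc j) (Suc k)))"
    have h: "h (prod_decode i) = a i * X i \<omega>" for i
      using that by (simp add: h_def a_def Y_def case_prod_unfold)
    have "summable (\<lambda>i. \<bar>h (prod_decode i)\<bar>)"
      unfolding h
      by (rule summable_comparison_test'[OF S.summable_abs, of 0])
        (simp only: real_norm_def abs_abs S.term_le)
    from suminf_prod_decode[OF this] show ?thesis
      unfolding h S.tail_def by (simp add: ostrogradsky_sum_def h_def)
  qed
  have meas: "ostrogradsky_sum q \<xi> \<in> borel_measurable M"
  proof -
    have [measurable]: "\<xi> (Suc j) (Suc k) \<in> borel_measurable M" for j k
      using assms(5) by (auto simp: indep_vars_def)
    show ?thesis unfolding ostrogradsky_sum_def[abs_def] by measurable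
  qed
  have distr_eq: "distr M borel (ostrogradsky_sum q \<xi>) = distr M borel (S.tail 0)"
    using meas X_eq_Y by (intro distr_cong_AE) (auto elim!: eventually_mono simp: sum_eq)
  have a_nz: "a i \<noteq> 0" for i
    using q_pos by (auto simp: a_def split: prod.splits)
  have mode: "S.mode_prob i = (case prod_decode i of (j, k) \<Rightarrow> max (p0 (Suc j) (Suc k)) (p1 (Suc j) (Suc k)))" for i
  proof -
    have "{\<omega> \<in> space M. X i \<omega> = 1} = {\<omega> \<in> space M. Y i \<omega> = 1}" by (auto simp: X_def)
    moreover from this have "prob {\<omega> \<in> space M. X i \<omega> = 0} = prob {\<omega> \<in> space M. Y i \<omega> = 0}"
      using S.prob_X[of i] prob_Y_sum[of i] by simp
    ultimately show ?thesis by (simp add: S.mode_prob_def prob_Y case_prod_unfold)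
  qed
  have "inf_product (\<lambda>j. inf_product (\<lambda>k. max (p0 j k) (p1 j k))) > 0 \<longleftrightarrow>
      (\<exists>c>0. \<forall>n. c \<le> (\<Prod>i<n. S.mode_prob i))"
    unfolding mode
  proof (rule iterated_inf_product_pos_iff)
    fix j k :: nat assume "j \<ge> 1" "k \<ge> 1"
    from p_sum[OF this] show "0 \<le> max (p0 j k) (p1 j k) \<and> max (p0 j k) (p1 j k) \<le> 1" by auto
  qed
  with S.pure_type S.purely_discrete_iff[OF a_nz] show ?thesis
    by (simp only: distr_eq simp_thms)
qed

end
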